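(* On $\mathrm{SL}_2(\mathbb{C}) = \left\{ \begin{pmatrix} a & b \\ c & d \end{pmatrix} : a,b,c,d \in \mathbb{C},\ ad - bc = 1 \right\}$ consider the vector fields $$V = c \frac{\partial}{\partial a} + d \frac{\partial}{\partial b}, \qquad W = a \frac{\partial}{\partial c} + b \frac{\partial}{\partial d}.$$ The group of holomorphic automorphisms generated by the flows of $V$, $W$, $(b+c)W$ and $dW$ acts infinitely transitively on $\mathrm{SL}_2(\mathbb{C})$.
   Context: The vector fields $V$, $W$, $(b+c)W$, $dW$ are tangent to $\mathrm{SL}_2(\mathbb{C})$ and complete, i.e. their flows exist for all complex times $t\in\mathbb{C}$; the group in question is generated by all time-$t$ flow maps. A group $G$ acts infinitely transitively on a set $Y$ if for every $m \in \mathbb{N}$ it acts $m$-transitively, i.e. for any pairwise distinct $p_1,\dots,p_m \in Y$ and any pairwise distinct $q_1,\dots,q_m \in Y$ there is $F \in G$ with $F(p_j) = q_j$ for $j=1,\dots,m$. *)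

theory Defs
  imports
    "HOL-Complex_Analysis.Cauchy_Integral_Formula"
    "HOL-Algebra.Bij"
    "HOL-Algebra.Generated_Groups"
begin

section \<open>Vector fields and the special linear group\<close>

definition SL2 :: "(complex^2^2) set"
  where "SL2 = {A. det A = 1}"

abbreviation mat2 :: "complex \<Rightarrow> complex \<Rightarrow> complex \<Rightarrow> complex \<Rightarrow> complex^2^2"
  where "mat2 a b c d \<equiv> vector [vector [a, b], vector [c, d]]"

abbreviation ent_a :: "complex^2^2 \<Rightarrow> complex" where "ent_a A \<equiv> A $ 1 $ 1"
abbreviation ent_b :: "complex^2^2 \<Rightarrow> complex" where "ent_b A \<equiv> A $ 1 $ 2"
abbreviation ent_c :: "complex^2^2 \<Rightarrow> complex" where "ent_c A \<equiv> A $ 2 $ 1"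
abbreviation ent_d :: "complex^2^2 \<Rightarrow> complex" where "ent_d A \<equiv> A $ 2 $ 2"

definition cscale :: "complex \<Rightarrow> complex^2^2 \<Rightarrow> complex^2^2"
  where "cscale z A = (\<chi> i j. z * A $ i $ j)"

text \<open>
  A vector field on the space of matrices is the function sending a point to its value; the
  coefficients of \<open>\<partial>/\<partial>a, \<partial>/\<partial>b, \<partial>/\<partial>c, \<partial>/\<partial>d\<close> are the entries of that value.
\<close>

definition V_field :: "complex^2^2 \<Rightarrow> complex^2^2"
  where "V_field A = mat2 (ent_c A) (ent_d A) 0 0"

definition W_field :: "complex^2^2 \<Rightarrow> complex^2^2"
  where "W_field A = mat2 0 0 (ent_a A) (ent_b A)"

definition mult_field ::
    "(complex^2^2 \<Rightarrow> complex) \<Rightarrow> (complex^2^2 \<Rightarrow> complex^2^2) \<Rightarrow> complex^2^2 \<Rightarrow> complex^2^2"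
  where "mult_field f X A = cscale (f A) (X A)"


section \<open>Holomorphic automorphisms\<close>

definition holomorphic_at :: "(complex^2^2 \<Rightarrow> complex^2^2) \<Rightarrow> complex^2^2 \<Rightarrow> bool"
  where "holomorphic_at F A \<longleftrightarrow>
    (\<exists>D. (F has_derivative D) (at A) \<and> (\<forall>z B. D (cscale z B) = cscale z (D B)))"

text \<open>
  Holomorphy on a closed complex submanifold \<open>S\<close> of the space of matrices: the map is locally the
  restriction of a holomorphic map of the ambient space.
\<close>

definition hol_map_on :: "(complex^2^2) set \<Rightarrow> (complex^2^2 \<Rightarrow> complex^2^2) \<Rightarrow> bool"
  where "hol_map_on S f \<longleftrightarrow>
    (\<forall>A\<in>S. \<exists>U F. open U \<and> A \<in> U \<and> (\<forall>B\<in>U. holomorphic_at F B) \<and> (\<forall>B\<in>S \<inter> U. f B = F B))"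

definition HolAut :: "(complex^2^2) set \<Rightarrow> (complex^2^2 \<Rightarrow> complex^2^2) monoid"
  where "HolAut S =
    (BijGroup S)\<lparr>carrier := {f \<in> Bij S. hol_map_on S f \<and> hol_map_on S (inv_into S f)}\<rparr>"


section \<open>Flows\<close>

text \<open>
  \<open>\<phi>\<close> is the global flow, in complex time, of the field \<open>X\<close> on \<open>S\<close>; only values on \<open>S\<close> matter.
\<close>

definition complex_flow ::
    "(complex^2^2) set \<Rightarrow> (complex^2^2 \<Rightarrow> complex^2^2) \<Rightarrow> (complex \<Rightarrow> complex^2^2 \<Rightarrow> complex^2^2) \<Rightarrow> bool"
  where "complex_flow S X \<phi> \<longleftrightarrow>
    (\<forall>A\<in>S. \<phi> 0 A = A \<and>
      (\<forall>t. \<phi> t A \<in> S \<and>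
        (\<forall>i j. ((\<lambda>s. \<phi> s A $ i $ j) has_field_derivative X (\<phi> t A) $ i $ j) (at t))))"

definition flow_maps ::
    "(complex^2^2) set \<Rightarrow> (complex^2^2 \<Rightarrow> complex^2^2) \<Rightarrow> (complex^2^2 \<Rightarrow> complex^2^2) set"
  where "flow_maps S X = {restrict (\<phi> t) S | \<phi> t. complex_flow S X \<phi>}"

definition flow_group ::
    "(complex^2^2) set \<Rightarrow> (complex^2^2 \<Rightarrow> complex^2^2) set \<Rightarrow> (complex^2^2 \<Rightarrow> complex^2^2) set"
  where "flow_group S \<X> = generate (HolAut S) (\<Union>X\<in>\<X>. flow_maps S X)"


section \<open>Infinite transitivity\<close>

definition m_transitive :: "('a \<Rightarrow> 'a) set \<Rightarrow> 'a set \<Rightarrow> nat \<Rightarrow> bool"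
  where "m_transitive G Y m \<longleftrightarrow>
    (\<forall>p q. p ` {1..m} \<subseteq> Y \<and> inj_on p {1..m} \<and> q ` {1..m} \<subseteq> Y \<and> inj_on q {1..m} \<longrightarrow>
      (\<exists>F\<in>G. \<forall>j\<in>{1..m}. F (p j) = q j))"

definition infinitely_transitive :: "('a \<Rightarrow> 'a) set \<Rightarrow> 'a set \<Rightarrow> bool"
  where "infinitely_transitive G Y \<longleftrightarrow> (\<forall>m. m_transitive G Y m)"


section \<open>Well-definedness\<close>

text \<open>
  The holomorphic automorphisms form a group, the four fields are complete on the special linear
  group, and their time maps are holomorphic automorphisms. So the group they generate is a
  subgroup of the automorphism group.
\<close>

lemma holomorphic_at_compose:
  assumes "holomorphic_at F A" "holomorphic_at G (F A)"
  shows "holomorphic_at (\<lambda>x. G (F x)) A"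
proof -
  obtain D E where D: "(F has_derivative D) (at A)" "\<forall>z B. D (cscale z B) = cscale z (D B)"
    and E: "(G has_derivative E) (at (F A))" "\<forall>z B. E (cscale z B) = cscale z (E B)"
    using assms unfolding holomorphic_at_def by blast
  have "((\<lambda>x. G (F x)) has_derivative (\<lambda>x. E (D x))) (at A)"
    using has_derivative_compose[OF D(1) E(1)] .
  then show ?thesis
    unfolding holomorphic_at_def using D(2) E(2) by (intro exI[of _ "\<lambda>x. E (D x)"]) simp
qed

lemma holomorphic_at_isCont: "holomorphic_at F A \<Longrightarrow> isCont F A"
  unfolding holomorphic_at_def using has_derivative_continuous by blast

lemma hol_map_on_id: "hol_map_on S (\<lambda>x\<in>S. x)"
proof -
  have "holomorphic_at (\<lambda>x. x) B" for B
    unfolding holomorphic_at_def by (intro exI[of _ "\<lambda>x. x"]) auto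
  then show ?thesis
    unfolding hol_map_on_def by (intro ballI exI[of _ UNIV] exI[of _ "\<lambda>x. x"]) simp
qed

lemma hol_map_on_cong: "(\<And>A. A \<in> S \<Longrightarrow> f A = g A) \<Longrightarrow> hol_map_on S f \<longleftrightarrow> hol_map_on S g"
  unfolding hol_map_on_def by simp

lemma hol_map_on_compose:
  assumes f: "hol_map_on S f" and g: "hol_map_on S g" and fS: "\<And>A. A \<in> S \<Longrightarrow> f A \<in> S"
  shows "hol_map_on S (\<lambda>x. g (f x))"
  unfolding hol_map_on_def
proof
  fix A assume A: "A \<in> S"
  obtain U F where U: "open U" "A \<in> U" "\<forall>B\<in>U. holomorphic_at F B" "\<forall>B\<in>S \<inter> U. f B = F B"
    using f A unfolding hol_map_on_def by blast
  obtain W G where W: "open W" "f A \<in> W" "\<forall>B\<in>W. holomorphic_at G B" "\<forall>B\<in>S \<inter> W. g B = G B"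
    using g fS[OF A] unfolding hol_map_on_def by blast
  have "continuous_on U F"
    using U(3) holomorphic_at_isCont continuous_at_imp_continuous_on by blast
  then have op: "open (U \<inter> F -` W)"
    using W(1) by (intro continuous_open_preimage[OF _ U(1)])
  show "\<exists>U F. open U \<and> A \<in> U \<and> (\<forall>B\<in>U. holomorphic_at F B) \<and> (\<forall>B\<in>S \<inter> U. g (f B) = F B)"
  proof (intro exI conjI ballI)
    show "open (U \<inter> F -` W)" by (rule op)
    have "f A = F A" using A U(2,4) by blast
    then show "A \<in> U \<inter> F -` W" using U(2) W(2) by simp
    show "holomorphic_at (\<lambda>x. G (F x)) B" if "B \<in> U \<inter> F -` W" for B
      using that U(3) W(3) by (intro holomorphic_at_compose[of F B G]) simp_all
    show "g (f B) = G (F B)" if "B \<in> S \<inter> (U \<inter> F -` W)" for B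
    proof -
      have "f B = F B" "f B \<in> S" using that U(4) fS by blast+
      then show ?thesis using that W(4) by simp
    qed
  qed
qed

lemma carrier_HolAut:
  "carrier (HolAut S) = {f \<in> Bij S. hol_map_on S f \<and> hol_map_on S (inv_into S f)}"
  by (simp add: HolAut_def)

lemma HolAut_subgroup: "subgroup (carrier (HolAut S)) (BijGroup S)"
proof (rule group.subgroupI[OF group_BijGroup])
  show "carrier (HolAut S) \<subseteq> carrier (BijGroup S)"
    by (auto simp: carrier_HolAut BijGroup_def)
  have "inv_into S (\<lambda>x\<in>S. x) A = A" if "A \<in> S" for A
    using that by (intro inv_into_f_eq) (auto simp: inj_on_def)
  then have "(\<lambda>x\<in>S. x) \<in> carrier (HolAut S)"
    using hol_map_on_cong[of S "inv_into S (\<lambda>x\<in>S. x)" "\<lambda>x\<in>S. x"]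
    by (simp add: carrier_HolAut id_Bij hol_map_on_id)
  then show "carrier (HolAut S) \<noteq> {}" by blast
next
  fix f assume f: "f \<in> carrier (HolAut S)"
  then have fB: "f \<in> Bij S" by (simp add: carrier_HolAut)
  have inv: "inv\<^bsub>BijGroup S\<^esub> f = restrict (inv_into S f) S"
    using fB by (rule inv_BijGroup)
  have bij: "bij_betw f S S" using fB by (simp add: Bij_def)
  have bij': "bij_betw (restrict (inv_into S f) S) S S"
    using restrict_inv_into_Bij[OF fB] by (simp add: Bij_def)
  have eq: "inv_into S (restrict (inv_into S f) S) A = f A" if "A \<in> S" for A
  proof (rule inv_into_f_eq)
    show "inj_on (restrict (inv_into S f) S) S" using bij' by (simp add: bij_betw_def)
    show "f A \<in> S" using bij that by (auto simp: bij_betw_def)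
    then show "restrict (inv_into S f) S (f A) = A"
      using bij that by (simp add: bij_betw_def)
  qed
  show "inv\<^bsub>BijGroup S\<^esub> f \<in> carrier (HolAut S)"
    unfolding inv carrier_HolAut mem_Collect_eq
  proof (intro conjI)
    show "hol_map_on S (restrict (inv_into S f) S)"
      using f hol_map_on_cong[of S "restrict (inv_into S f) S" "inv_into S f"]
      by (simp add: carrier_HolAut)
    show "hol_map_on S (inv_into S (restrict (inv_into S f) S))"
      using f eq hol_map_on_cong[of S "inv_into S (restrict (inv_into S f) S)" f]
      by (simp add: carrier_HolAut)
  qed (use restrict_inv_into_Bij[OF fB] in simp)
next
  fix f g assume f: "f \<in> carrier (HolAut S)" and g: "g \<in> carrier (HolAut S)"
  then have fB: "f \<in> Bij S" and gB: "g \<in> Bij S" by (simp_all add: carrier_HolAut)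
  have f1: "bij_betw f S S" and g1: "bij_betw g S S" using fB gB by (simp_all add: Bij_def)
  have mult: "f \<otimes>\<^bsub>BijGroup S\<^esub> g = compose S f g"
    using fB gB by (simp add: BijGroup_def)
  have c: "compose S f g \<in> Bij S" using fB gB by (rule compose_Bij)
  have eq: "inv_into S (compose S f g) A = inv_into S g (inv_into S f A)" if "A \<in> S" for A
  proof (rule inv_into_f_eq)
    show "inj_on (compose S f g) S" using c by (simp add: Bij_def bij_betw_def)
    have m1: "inv_into S f A \<in> S" by (rule Bij_inv_into_mem[OF fB that])
    show m2: "inv_into S g (inv_into S f A) \<in> S" by (rule Bij_inv_into_mem[OF gB m1])
    show "compose S f g (inv_into S g (inv_into S f A)) = A"
    proof -
      have "g (inv_into S g (inv_into S f A)) = inv_into S f A"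
        using bij_betw_inv_into_right[OF g1 m1] .
      moreover have "f (inv_into S f A) = A"
        using bij_betw_inv_into_right[OF f1 that] .
      ultimately show ?thesis using m2 by (simp add: compose_def)
    qed
  qed
  show "f \<otimes>\<^bsub>BijGroup S\<^esub> g \<in> carrier (HolAut S)"
    unfolding mult carrier_HolAut mem_Collect_eq
  proof (intro conjI)
    have hol: "hol_map_on S f" "hol_map_on S (inv_into S f)"
      "hol_map_on S g" "hol_map_on S (inv_into S g)"
      using f g by (simp_all add: carrier_HolAut)
    have "g A \<in> S" if "A \<in> S" for A
      using bij_betwE[OF g1] that by blast
    from hol_map_on_compose[OF hol(3) hol(1) this]
    show "hol_map_on S (compose S f g)"
      by (rule iffD1[OF hol_map_on_cong, rotated]) (simp_all add: compose_def)
    from hol_map_on_compose[OF hol(2) hol(4) Bij_inv_into_mem[OF fB]]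
    show "hol_map_on S (inv_into S (compose S f g))"
      by (rule iffD1[OF hol_map_on_cong, rotated]) (simp_all add: eq)
  qed (rule c)
qed

lemma group_HolAut: "group (HolAut S)"
  using group.subgroup_imp_group[OF group_BijGroup HolAut_subgroup[of S]]
  unfolding carrier_HolAut HolAut_def[symmetric] .

subsection \<open>Holomorphy of maps given by their entries\<close>

definition hol_fun_at :: "(complex^2^2 \<Rightarrow> complex) \<Rightarrow> complex^2^2 \<Rightarrow> bool"
  where "hol_fun_at f A \<longleftrightarrow>
    (\<exists>D. (f has_derivative D) (at A) \<and> (\<forall>z B. D (cscale z B) = z * D B))"

lemma hol_fun_at_entry: "hol_fun_at (\<lambda>A. A $ i $ j) A"
  unfolding hol_fun_at_def
proof (intro exI conjI)
  have "bounded_linear (\<lambda>A::complex^2^2. A $ i $ j)"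
    using bounded_linear_compose[OF bounded_linear_vec_nth bounded_linear_vec_nth] .
  then show "((\<lambda>A::complex^2^2. A $ i $ j) has_derivative (\<lambda>A. A $ i $ j)) (at A)"
    by (rule bounded_linear_imp_has_derivative)
qed (simp add: cscale_def)

lemma hol_fun_at_const: "hol_fun_at (\<lambda>A. k) A"
  unfolding hol_fun_at_def by (intro exI[of _ "\<lambda>_. 0"]) auto

lemma hol_fun_at_add:
  assumes "hol_fun_at f A" "hol_fun_at g A"
  shows "hol_fun_at (\<lambda>A. f A + g A) A"
proof -
  obtain D E where "(f has_derivative D) (at A)" "\<forall>z B. D (cscale z B) = z * D B"
    "(g has_derivative E) (at A)" "\<forall>z B. E (cscale z B) = z * E B"
    using assms unfolding hol_fun_at_def by blast
  then show ?thesis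
    unfolding hol_fun_at_def
    by (intro exI[of _ "\<lambda>x. D x + E x"]) (auto intro!: has_derivative_add simp: algebra_simps)
qed

lemma hol_fun_at_mult:
  assumes "hol_fun_at f A" "hol_fun_at g A"
  shows "hol_fun_at (\<lambda>A. f A * g A) A"
proof -
  obtain D E where "(f has_derivative D) (at A)" "\<forall>z B. D (cscale z B) = z * D B"
    "(g has_derivative E) (at A)" "\<forall>z B. E (cscale z B) = z * E B"
    using assms unfolding hol_fun_at_def by blast
  then show ?thesis
    unfolding hol_fun_at_def
    by (intro exI[of _ "\<lambda>x. f A * E x + D x * g A"] conjI has_derivative_mult)
       (auto simp: algebra_simps)
qed

lemma hol_fun_at_diff:
  assumes "hol_fun_at f A" "hol_fun_at g A"
  shows "hol_fun_at (\<lambda>A. f A - g A) A"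
  using hol_fun_at_add[OF assms(1) hol_fun_at_mult[OF hol_fun_at_const[of "-1"] assms(2)]] by simp

lemma hol_fun_at_compose:
  assumes "hol_fun_at f A" "h field_differentiable (at (f A))"
  shows "hol_fun_at (\<lambda>A. h (f A)) A"
proof -
  obtain D h' where D: "(f has_derivative D) (at A)" "\<forall>z B. D (cscale z B) = z * D B"
    and h: "(h has_derivative (*) h') (at (f A))"
    using assms unfolding hol_fun_at_def field_differentiable_def has_field_derivative_def by blast
  show ?thesis
    unfolding hol_fun_at_def using has_derivative_compose[OF D(1) h] D(2)
    by (intro exI[of _ "\<lambda>x. h' * D x"]) auto
qed

lemma has_derivative_vec:
  fixes f :: "'a::real_normed_vector \<Rightarrow> 'b::euclidean_space ^ 'n"
  assumes "\<And>i. ((\<lambda>x. f x $ i) has_derivative (\<lambda>x. f' x $ i)) (at A)"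
  shows "(f has_derivative f') (at A)"
  unfolding has_derivative_componentwise_within[of f]
proof
  fix u :: "'b ^ 'n" assume "u \<in> Basis"
  then obtain i b where u: "u = axis i b" by (auto simp: Basis_vec_def)
  show "((\<lambda>x. f x \<bullet> u) has_derivative (\<lambda>x. f' x \<bullet> u)) (at A)"
    unfolding u inner_axis by (rule has_derivative_inner_left[OF assms])
qed

lemma holomorphic_at_mat2:
  assumes "hol_fun_at f A" "hol_fun_at g A" "hol_fun_at h A" "hol_fun_at k A"
  shows "holomorphic_at (\<lambda>A. mat2 (f A) (g A) (h A) (k A)) A"
proof -
  obtain P where P: "(f has_derivative P) (at A)" "\<forall>z B. P (cscale z B) = z * P B"
    using assms(1) unfolding hol_fun_at_def by blast
  obtain Q where Q: "(g has_derivative Q) (at A)" "\<forall>z B. Q (cscale z B) = z * Q B"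
    using assms(2) unfolding hol_fun_at_def by blast
  obtain R where R: "(h has_derivative R) (at A)" "\<forall>z B. R (cscale z B) = z * R B"
    using assms(3) unfolding hol_fun_at_def by blast
  obtain T where T: "(k has_derivative T) (at A)" "\<forall>z B. T (cscale z B) = z * T B"
    using assms(4) unfolding hol_fun_at_def by blast
  have row: "((\<lambda>A. vector [p A, q A] :: complex^2) has_derivative (\<lambda>B. vector [p' B, q' B])) (at A)"
    if "(p has_derivative p') (at A)" "(q has_derivative q') (at A)" for p q p' q'
  proof (rule has_derivative_vec)
    fix i :: 2
    show "((\<lambda>A. (vector [p A, q A] :: complex^2) $ i) has_derivative (\<lambda>B. vector [p' B, q' B] $ i)) (at A)"
      using exhaust_2[of i] that by auto
  qed
  have "((\<lambda>A. mat2 (f A) (g A) (h A) (k A)) has_derivative (\<lambda>B. mat2 (P B) (Q B) (R B) (T B))) (at A)"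
  proof (rule has_derivative_vec)
    fix i :: 2
    show "((\<lambda>A. mat2 (f A) (g A) (h A) (k A) $ i) has_derivative
        (\<lambda>B. mat2 (P B) (Q B) (R B) (T B) $ i)) (at A)"
      using exhaust_2[of i] row[OF P(1) Q(1)] row[OF R(1) T(1)] by auto
  qed
  moreover have "mat2 (P (cscale z B)) (Q (cscale z B)) (R (cscale z B)) (T (cscale z B)) =
      cscale z (mat2 (P B) (Q B) (R B) (T B))" for z B
    using P(2) Q(2) R(2) T(2) by (simp add: vec_eq_iff forall_2 cscale_def)
  ultimately show ?thesis
    unfolding holomorphic_at_def by blast
qed

subsection \<open>Explicit flows\<close>

lemma flow_maps_HolAut:
  assumes flow: "complex_flow SL2 X \<Phi>"
    and uniq: "\<And>\<gamma> t. (\<And>t i j. ((\<lambda>s. \<gamma> s $ i $ j) has_field_derivative X (\<gamma> t) $ i $ j) (at t))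
      \<Longrightarrow> \<gamma> t = \<Phi> t (\<gamma> 0)"
    and hol: "\<And>t A. holomorphic_at (\<Phi> t) A"
  shows "flow_maps SL2 X \<subseteq> carrier (HolAut SL2)"
proof
  fix f assume "f \<in> flow_maps SL2 X"
  then obtain \<phi> t where \<phi>: "complex_flow SL2 X \<phi>" and f: "f = restrict (\<phi> t) SL2"
    unfolding flow_maps_def by blast
  have "\<phi> t A = \<Phi> t A" if "A \<in> SL2" for A
    using uniq[of "\<lambda>s. \<phi> s A" t] \<phi> that unfolding complex_flow_def by auto
  then have f: "f = restrict (\<Phi> t) SL2" unfolding f by auto
  have mem: "\<Phi> s A \<in> SL2" and zero: "\<Phi> 0 A = A" if "A \<in> SL2" for s A
    using flow that unfolding complex_flow_def by blast+
  have law: "\<Phi> (s + r) A = \<Phi> s (\<Phi> r A)" if "A \<in> SL2" for s r A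
  proof -
    have "((\<lambda>s. \<Phi> (s + r) A $ i $ j) has_field_derivative X (\<Phi> (u + r) A) $ i $ j) (at u)" for u i j
      using flow that DERIV_shift[of "\<lambda>s. \<Phi> s A $ i $ j" "X (\<Phi> (u + r) A) $ i $ j" u r]
      unfolding complex_flow_def by blast
    from uniq[of "\<lambda>s. \<Phi> (s + r) A", OF this] show ?thesis by simp
  qed
  have inv1: "\<Phi> (- s) (\<Phi> s A) = A" if "A \<in> SL2" for s A
    using law[OF that, of "-s" s] zero[OF that] by simp
  have inv2: "\<Phi> s (\<Phi> (- s) A) = A" if "A \<in> SL2" for s A
    using law[OF that, of s "-s"] zero[OF that] by simp
  have bij: "bij_betw (\<Phi> t) SL2 SL2"
    by (rule bij_betw_byWitness[of _ "\<Phi> (- t)"]) (auto simp: inv1 inv2 mem)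
  then have fB: "f \<in> Bij SL2" unfolding Bij_def f by (simp add: bij_betw_restrict_eq)
  have inv: "inv_into SL2 f A = \<Phi> (- t) A" if "A \<in> SL2" for A
    using fB that by (intro inv_into_f_eq) (auto simp: Bij_def bij_betw_def f mem inv2)
  have h: "hol_map_on SL2 (\<Phi> s)" for s
    unfolding hol_map_on_def using hol by (auto intro!: exI[of _ UNIV] exI[of _ "\<Phi> s"])
  show "f \<in> carrier (HolAut SL2)"
    unfolding carrier_HolAut using fB h inv hol_map_on_cong[of SL2 f "\<Phi> t"]
      hol_map_on_cong[of SL2 "inv_into SL2 f" "\<Phi> (- t)"] by (simp add: f)
qed

lemma mat2_eq_iff:
  "A = mat2 a b c d \<longleftrightarrow> ent_a A = a \<and> ent_b A = b \<and> ent_c A = c \<and> ent_d A = d"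
  by (auto simp: vec_eq_iff forall_2)

lemma DERIV_zero_imp_const:
  fixes f :: "complex \<Rightarrow> complex"
  assumes "\<And>t. (f has_field_derivative 0) (at t)"
  shows "f t = f 0"
  using has_field_derivative_zero_constant[of UNIV f] assms by auto

lemma DERIV_const_imp_linear:
  fixes f :: "complex \<Rightarrow> complex"
  assumes "\<And>t. (f has_field_derivative k) (at t)"
  shows "f t = f 0 + t * k"
proof -
  have "((\<lambda>t. f t - t * k) has_field_derivative 0) (at t)" for t
    by (auto intro!: derivative_eq_intros assms)
  from DERIV_zero_imp_const[OF this, of t] show ?thesis by (simp add: algebra_simps)
qed

text \<open>The primitive of \<open>exp (z * t)\<close> in \<open>t\<close> vanishing at \<open>t = 0\<close>.\<close>

definition exp_prim :: "complex \<Rightarrow> complex \<Rightarrow> complex"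
  where "exp_prim t z = (if z = 0 then t else (exp (z * t) - 1) / z)"

lemma exp_prim_mult: "z * exp_prim t z = exp (z * t) - 1"
  by (simp add: exp_prim_def)

lemma exp_prim_0 [simp]: "exp_prim 0 z = 0"
  by (simp add: exp_prim_def)

lemma DERIV_exp_prim: "((\<lambda>t. exp_prim t z) has_field_derivative exp (z * t)) (at t)"
  by (cases "z = 0") (auto simp: exp_prim_def intro!: derivative_eq_intros)

lemma exp_prim_differentiable: "exp_prim t field_differentiable (at z)"
proof -
  have h: "(\<lambda>z. exp (z * t)) holomorphic_on UNIV" by (intro holomorphic_intros)
  have "deriv (\<lambda>z. exp (z * t)) 0 = t"
    by (rule DERIV_imp_deriv) (auto intro!: derivative_eq_intros)
  then have "exp_prim t = (\<lambda>z. if z = 0 then deriv (\<lambda>z. exp (z * t)) 0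
      else (exp (z * t) - exp (0 * t)) / (z - 0))"
    by (auto simp: exp_prim_def)
  then have "exp_prim t holomorphic_on UNIV"
    using pole_lemma_open[OF h open_UNIV, of 0] by simp
  then show ?thesis by (simp add: holomorphic_on_def)
qed

lemma DERIV_exp_imp_exp_prim:
  fixes f :: "complex \<Rightarrow> complex"
  assumes "\<And>t. (f has_field_derivative k * exp (z * t)) (at t)"
  shows "f t = f 0 + k * exp_prim t z"
proof -
  have "((\<lambda>t. f t - k * exp_prim t z) has_field_derivative 0) (at t)" for t
    by (auto intro!: derivative_eq_intros assms DERIV_exp_prim)
  from DERIV_zero_imp_const[OF this, of t] show ?thesis by (simp add: algebra_simps)
qed

lemma DERIV_linear_imp_exp:
  fixes f :: "complex \<Rightarrow> complex"
  assumes "\<And>t. (f has_field_derivative f t * z) (at t)"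
  shows "f t = f 0 * exp (z * t)"
proof -
  have "((\<lambda>t. f t * exp (- z * t)) has_field_derivative 0) (at t)" for t
    by (auto intro!: derivative_eq_intros assms simp: algebra_simps)
  from DERIV_zero_imp_const[OF this, of t] have "f t * exp (- (z * t)) = f 0" by simp
  then show ?thesis by (simp add: exp_minus field_simps)
qed

definition V_flow :: "complex \<Rightarrow> complex^2^2 \<Rightarrow> complex^2^2"
  where "V_flow t A = mat2 (ent_a A + t * ent_c A) (ent_b A + t * ent_d A) (ent_c A) (ent_d A)"

definition W_flow :: "complex \<Rightarrow> complex^2^2 \<Rightarrow> complex^2^2"
  where "W_flow t A = mat2 (ent_a A) (ent_b A) (ent_c A + t * ent_a A) (ent_d A + t * ent_b A)"

definition bcW_flow :: "complex \<Rightarrow> complex^2^2 \<Rightarrow> complex^2^2"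
  where "bcW_flow t A = mat2 (ent_a A) (ent_b A)
    ((ent_b A + ent_c A) * exp (ent_a A * t) - ent_b A)
    (ent_d A + ent_b A * (ent_b A + ent_c A) * exp_prim t (ent_a A))"

definition dW_flow :: "complex \<Rightarrow> complex^2^2 \<Rightarrow> complex^2^2"
  where "dW_flow t A = mat2 (ent_a A) (ent_b A)
    (ent_c A + ent_a A * ent_d A * exp_prim t (ent_b A)) (ent_d A * exp (ent_b A * t))"

lemmas field_defs = V_field_def W_field_def mult_field_def cscale_def

lemma V_complete: "complex_flow SL2 V_field V_flow"
  by (auto simp: complex_flow_def SL2_def det_2 forall_2 V_flow_def field_defs
      vec_eq_iff algebra_simps intro!: derivative_eq_intros)

lemma W_complete: "complex_flow SL2 W_field W_flow"
  by (auto simp: complex_flow_def SL2_def det_2 forall_2 W_flow_def field_defs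
      vec_eq_iff algebra_simps intro!: derivative_eq_intros)

lemma bcW_complete: "complex_flow SL2 (mult_field (\<lambda>A. ent_b A + ent_c A) W_field) bcW_flow"
proof -
  have "a * (d + b * (b + c) * exp_prim t a) - b * ((b + c) * exp (a * t) - b) = a * d - b * c"
    for a b c d t
  proof -
    have "a * (d + b * (b + c) * exp_prim t a) = a * d + b * (b + c) * (a * exp_prim t a)"
      by (simp add: algebra_simps)
    then show ?thesis unfolding exp_prim_mult by (simp add: algebra_simps)
  qed
  then show ?thesis
    by (auto simp: complex_flow_def SL2_def det_2 forall_2 bcW_flow_def field_defs
        vec_eq_iff intro!: derivative_eq_intros DERIV_exp_prim)
qed

lemma dW_complete: "complex_flow SL2 (mult_field (\<lambda>A. ent_d A) W_field) dW_flow"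
proof -
  have "a * (d * exp (b * t)) - b * (c + a * d * exp_prim t b) = a * d - b * c" for a b c d t
  proof -
    have "b * (c + a * d * exp_prim t b) = b * c + a * d * (b * exp_prim t b)"
      by (simp add: algebra_simps)
    then show ?thesis unfolding exp_prim_mult by (simp add: algebra_simps)
  qed
  then show ?thesis
    by (auto simp: complex_flow_def SL2_def det_2 forall_2 dW_flow_def field_defs
        vec_eq_iff intro!: derivative_eq_intros DERIV_exp_prim)
qed

lemmas hol_fun_intros = hol_fun_at_add hol_fun_at_diff hol_fun_at_mult hol_fun_at_entry
  hol_fun_at_const

lemma hol_fun_at_exp: "hol_fun_at (\<lambda>A. exp (A $ i $ j * t)) A"
  by (rule hol_fun_at_compose[of "\<lambda>A. A $ i $ j * t" A exp])
     (auto intro: hol_fun_intros field_differentiable_within_exp)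

lemma hol_fun_at_exp_prim: "hol_fun_at (\<lambda>A. exp_prim t (A $ i $ j)) A"
  by (rule hol_fun_at_compose[OF hol_fun_at_entry exp_prim_differentiable])

lemma V_flow_maps: "flow_maps SL2 V_field \<subseteq> carrier (HolAut SL2)"
proof (rule flow_maps_HolAut[OF V_complete])
  fix t and \<gamma> :: "complex \<Rightarrow> complex^2^2"
  assume \<gamma>: "\<And>t i j. ((\<lambda>s. \<gamma> s $ i $ j) has_field_derivative V_field (\<gamma> t) $ i $ j) (at t)"
  have c: "ent_c (\<gamma> t) = ent_c (\<gamma> 0)" and d: "ent_d (\<gamma> t) = ent_d (\<gamma> 0)" for t
    using \<gamma>[of 2 1] \<gamma>[of 2 2] DERIV_zero_imp_const[of "\<lambda>t. ent_c (\<gamma> t)" t]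
      DERIV_zero_imp_const[of "\<lambda>t. ent_d (\<gamma> t)" t] by (simp_all add: field_defs)
  have a': "((\<lambda>t. ent_a (\<gamma> t)) has_field_derivative ent_c (\<gamma> 0)) (at t)" for t
    using \<gamma>[of 1 1 t] c[of t] by (simp add: field_defs)
  have a: "ent_a (\<gamma> t) = ent_a (\<gamma> 0) + t * ent_c (\<gamma> 0)"
    by (rule DERIV_const_imp_linear) (rule a')
  have b': "((\<lambda>t. ent_b (\<gamma> t)) has_field_derivative ent_d (\<gamma> 0)) (at t)" for t
    using \<gamma>[of 1 2 t] d[of t] by (simp add: field_defs)
  have b: "ent_b (\<gamma> t) = ent_b (\<gamma> 0) + t * ent_d (\<gamma> 0)"
    by (rule DERIV_const_imp_linear) (rule b')
  show "\<gamma> t = V_flow t (\<gamma> 0)"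
    unfolding V_flow_def mat2_eq_iff using a b c[of t] d[of t] by simp
next
  show "holomorphic_at (V_flow t) A" for t A
    unfolding V_flow_def[abs_def] by (intro holomorphic_at_mat2 hol_fun_intros)
qed

lemma row1_const:
  assumes \<gamma>: "\<And>t i j. ((\<lambda>s. \<gamma> s $ i $ j) has_field_derivative mult_field f W_field (\<gamma> t) $ i $ j) (at t)"
  shows "ent_a (\<gamma> t) = ent_a (\<gamma> 0)" "ent_b (\<gamma> t) = ent_b (\<gamma> 0)"
  using \<gamma>[of 1 1] \<gamma>[of 1 2] DERIV_zero_imp_const[of "\<lambda>t. ent_a (\<gamma> t)" t]
    DERIV_zero_imp_const[of "\<lambda>t. ent_b (\<gamma> t)" t] by (simp_all add: field_defs)

lemma W_flow_maps: "flow_maps SL2 W_field \<subseteq> carrier (HolAut SL2)"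
proof (rule flow_maps_HolAut[OF W_complete])
  fix t and \<gamma> :: "complex \<Rightarrow> complex^2^2"
  assume \<gamma>: "\<And>t i j. ((\<lambda>s. \<gamma> s $ i $ j) has_field_derivative W_field (\<gamma> t) $ i $ j) (at t)"
  have one: "mult_field (\<lambda>_. 1) W_field = W_field"
    by (auto simp: fun_eq_iff vec_eq_iff field_defs)
  note ab = row1_const[of \<gamma> "\<lambda>_. 1", unfolded one, OF \<gamma>]
  have c': "((\<lambda>t. ent_c (\<gamma> t)) has_field_derivative ent_a (\<gamma> 0)) (at t)" for t
    using \<gamma>[of 2 1 t] ab(1)[of t] by (simp add: field_defs)
  have c: "ent_c (\<gamma> t) = ent_c (\<gamma> 0) + t * ent_a (\<gamma> 0)"
    by (rule DERIV_const_imp_linear) (rule c')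
  have d': "((\<lambda>t. ent_d (\<gamma> t)) has_field_derivative ent_b (\<gamma> 0)) (at t)" for t
    using \<gamma>[of 2 2 t] ab(2)[of t] by (simp add: field_defs)
  have d: "ent_d (\<gamma> t) = ent_d (\<gamma> 0) + t * ent_b (\<gamma> 0)"
    by (rule DERIV_const_imp_linear) (rule d')
  show "\<gamma> t = W_flow t (\<gamma> 0)"
    unfolding W_flow_def mat2_eq_iff using ab[of t] c d by simp
next
  show "holomorphic_at (W_flow t) A" for t A
    unfolding W_flow_def[abs_def] by (intro holomorphic_at_mat2 hol_fun_intros)
qed

lemma bcW_flow_maps:
  "flow_maps SL2 (mult_field (\<lambda>A. ent_b A + ent_c A) W_field) \<subseteq> carrier (HolAut SL2)"
proof (rule flow_maps_HolAut[OF bcW_complete])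
  fix t and \<gamma> :: "complex \<Rightarrow> complex^2^2"
  assume \<gamma>: "\<And>t i j. ((\<lambda>s. \<gamma> s $ i $ j) has_field_derivative
    mult_field (\<lambda>A. ent_b A + ent_c A) W_field (\<gamma> t) $ i $ j) (at t)"
  note ab = row1_const[of \<gamma>, OF \<gamma>]
  have "((\<lambda>t. ent_b (\<gamma> 0) + ent_c (\<gamma> t)) has_field_derivative
      (ent_b (\<gamma> 0) + ent_c (\<gamma> t)) * ent_a (\<gamma> 0)) (at t)" for t
    using DERIV_add[OF DERIV_const \<gamma>[of 2 1 t], of "ent_b (\<gamma> 0)"] ab[of t]
    by (simp add: field_defs)
  from DERIV_linear_imp_exp[OF this]
  have bc: "ent_b (\<gamma> 0) + ent_c (\<gamma> t) = (ent_b (\<gamma> 0) + ent_c (\<gamma> 0)) * exp (ent_a (\<gamma> 0) * t)" for t .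
  have "((\<lambda>t. ent_d (\<gamma> t)) has_field_derivative
      (ent_b (\<gamma> 0) * (ent_b (\<gamma> 0) + ent_c (\<gamma> 0))) * exp (ent_a (\<gamma> 0) * t)) (at t)" for t
    using \<gamma>[of 2 2 t] ab[of t] bc[of t] by (simp add: field_defs mult_ac)
  from DERIV_exp_imp_exp_prim[OF this, of t] bc[of t]
  show "\<gamma> t = bcW_flow t (\<gamma> 0)"
    unfolding bcW_flow_def mat2_eq_iff using ab[of t] by (simp add: eq_diff_eq add.commute)
next
  show "holomorphic_at (bcW_flow t) A" for t A
    unfolding bcW_flow_def[abs_def]
    by (intro holomorphic_at_mat2 hol_fun_intros hol_fun_at_exp hol_fun_at_exp_prim)
qed

lemma dW_flow_maps: "flow_maps SL2 (mult_field (\<lambda>A. ent_d A) W_field) \<subseteq> carrier (HolAut SL2)"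
proof (rule flow_maps_HolAut[OF dW_complete])
  fix t and \<gamma> :: "complex \<Rightarrow> complex^2^2"
  assume \<gamma>: "\<And>t i j. ((\<lambda>s. \<gamma> s $ i $ j) has_field_derivative
    mult_field (\<lambda>A. ent_d A) W_field (\<gamma> t) $ i $ j) (at t)"
  note ab = row1_const[of \<gamma>, OF \<gamma>]
  have "((\<lambda>t. ent_d (\<gamma> t)) has_field_derivative ent_d (\<gamma> t) * ent_b (\<gamma> 0)) (at t)" for t
    using \<gamma>[of 2 2 t] ab[of t] by (simp add: field_defs)
  from DERIV_linear_imp_exp[OF this]
  have d: "ent_d (\<gamma> t) = ent_d (\<gamma> 0) * exp (ent_b (\<gamma> 0) * t)" for t .
  have "((\<lambda>t. ent_c (\<gamma> t)) has_field_derivative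
      (ent_a (\<gamma> 0) * ent_d (\<gamma> 0)) * exp (ent_b (\<gamma> 0) * t)) (at t)" for t
    using \<gamma>[of 2 1 t] ab[of t] d[of t] by (simp add: field_defs mult_ac)
  from DERIV_exp_imp_exp_prim[OF this, of t] d[of t]
  show "\<gamma> t = dW_flow t (\<gamma> 0)"
    unfolding dW_flow_def mat2_eq_iff using ab[of t] by simp
next
  show "holomorphic_at (dW_flow t) A" for t A
    unfolding dW_flow_def[abs_def]
    by (intro holomorphic_at_mat2 hol_fun_intros hol_fun_at_exp hol_fun_at_exp_prim)
qed

lemma flow_group_subgroup:
  "subgroup
    (flow_group SL2
      {V_field, W_field,
       mult_field (\<lambda>A. ent_b A + ent_c A) W_field,
       mult_field (\<lambda>A. ent_d A) W_field})
    (HolAut SL2)"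
  unfolding flow_group_def
  by (rule group.generate_is_subgroup[OF group_HolAut])
     (use V_flow_maps W_flow_maps bcW_flow_maps dW_flow_maps in blast)

end

theory Submission
  imports Defs "HOL-Computational_Algebra.Polynomial"
begin

text \<open>
  All four fields are multiples of \<open>V\<close> or \<open>W\<close>, so every flow adds a multiple of one row of the
  matrix to the other. The flows of \<open>V\<close> and \<open>W\<close> alone give the left translations by constant
  matrices, which treat all points alike. The fields \<open>(b + c) W\<close> and \<open>d W\<close> supply shears whose
  amount depends on the point. Conjugating the flow of \<open>d W\<close> by the flow of \<open>W\<close>, which shifts
  \<open>d\<close> by a multiple of \<open>b\<close>, and correcting by \<open>W\<close> leaves the shear that adds \<open>s * exp (t * b)\<close>
  times row 1 to row 2, whose amount depends on the first row only; in the same way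
  \<open>(b + c) W\<close> gives the amounts \<open>s * exp (t * a)\<close> (\<open>realised_lower_exp\<close>).

  Shears with amounts depending on \<open>a\<close> alone add up, so every polynomial in \<open>exp (t * a)\<close> is
  available. Lagrange interpolation at finitely many values of \<open>a\<close> then produces a shear that
  acts by any prescribed constant at one value and trivially at the others
  (\<open>realised_lower_delta\<close>). Rotating by the Weyl element exchanges the rows and gives the same for
  upper shears and \<open>c\<close> (\<open>realised_upper_delta\<close>).

  Infinite transitivity follows, by induction on the number of points, once a point \<open>x\<close> can be
  moved to a point \<open>y\<close> with a given finite set \<open>E\<close> fixed pointwise (\<open>move_point\<close>).
  Conjugation by a suitable group element puts \<open>E\<close>, \<open>x\<close> and \<open>y\<close> in general position
  (\<open>general_position\<close>): their entries \<open>a\<close> are nonzero and pairwise different, and so are their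
  entries \<open>c\<close>. Now \<open>y x\<^sup>-\<^sup>1\<close> is a product of four constant shears, alternately lower and upper,
  with one free parameter. For all but finitely many values of the parameter the moving point
  never shares the relevant entry (\<open>a\<close> before a lower, \<open>c\<close> before an upper shear) with a point of
  \<open>E\<close> (\<open>four_shears\<close>), so each constant shear can be replaced by an interpolating one that leaves
  \<open>E\<close> alone.
\<close>

section \<open>Maps realised by the group generated by the flows\<close>

abbreviation fields :: "(complex^2^2 \<Rightarrow> complex^2^2) set" where
  "fields \<equiv> {V_field, W_field, mult_field (\<lambda>A. ent_b A + ent_c A) W_field,
    mult_field (\<lambda>A. ent_d A) W_field}"

text \<open>
  The elements of the group are extensional: outside \<open>SL2\<close> they take a dummy value. Shears are
  given by formulas on all matrices, so they are compared with group elements on \<open>SL2\<close> only.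
\<close>

definition realised :: "(complex^2^2 \<Rightarrow> complex^2^2) \<Rightarrow> bool" where
  "realised f \<longleftrightarrow> (\<exists>F\<in>flow_group SL2 fields. \<forall>A\<in>SL2. F A = f A)"

lemma realisedI:
  "F \<in> flow_group SL2 fields \<Longrightarrow> (\<And>A. A \<in> SL2 \<Longrightarrow> F A = f A) \<Longrightarrow> realised f"
  unfolding realised_def by blast

lemma flow_group_Bij: "F \<in> flow_group SL2 fields \<Longrightarrow> F \<in> Bij SL2"
  using subgroup.subset[OF flow_group_subgroup] by (auto simp: carrier_HolAut)

lemma realised_mem:
  assumes "realised f" "A \<in> SL2"
  shows "f A \<in> SL2"
proof -
  obtain F where F: "F \<in> flow_group SL2 fields" "\<forall>A\<in>SL2. F A = f A"
    using assms(1) unfolding realised_def by blast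
  then show ?thesis
    using flow_group_Bij[OF F(1)] assms(2) by (auto simp: Bij_def dest: bij_betwE)
qed

lemma realised_cong: "realised f \<Longrightarrow> (\<And>A. A \<in> SL2 \<Longrightarrow> f A = g A) \<Longrightarrow> realised g"
  unfolding realised_def by auto

lemma realised_id: "realised (\<lambda>A. A)"
proof -
  have "\<one>\<^bsub>HolAut SL2\<^esub> \<in> flow_group SL2 fields"
    by (rule subgroup.one_closed[OF flow_group_subgroup])
  moreover have "\<one>\<^bsub>HolAut SL2\<^esub> = (\<lambda>A\<in>SL2. A)"
    by (simp add: HolAut_def BijGroup_def)
  ultimately show ?thesis by (intro realisedI[of "\<lambda>A\<in>SL2. A"]) auto
qed

lemma realised_compose:
  assumes "realised f" "realised g"
  shows "realised (\<lambda>A. f (g A))"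
proof -
  obtain F G where F: "F \<in> flow_group SL2 fields" "\<forall>A\<in>SL2. F A = f A"
    and G: "G \<in> flow_group SL2 fields" "\<forall>A\<in>SL2. G A = g A"
    using assms unfolding realised_def by blast
  have "F \<otimes>\<^bsub>HolAut SL2\<^esub> G \<in> flow_group SL2 fields"
    by (rule subgroup.m_closed[OF flow_group_subgroup F(1) G(1)])
  moreover have "F \<otimes>\<^bsub>HolAut SL2\<^esub> G = compose SL2 F G"
    using flow_group_Bij[OF F(1)] flow_group_Bij[OF G(1)]
    by (simp add: HolAut_def BijGroup_def)
  moreover have "compose SL2 F G A = f (g A)" if "A \<in> SL2" for A
    using that F(2) G(2) realised_mem[OF assms(2) that] by (simp add: compose_def)
  ultimately show ?thesis by (intro realisedI[of "compose SL2 F G"]) auto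
qed

lemma realised_inverse:
  assumes "realised f"
  obtains g where "realised g" "\<And>A. A \<in> SL2 \<Longrightarrow> g (f A) = A"
proof -
  obtain F where F: "F \<in> flow_group SL2 fields" "\<forall>A\<in>SL2. F A = f A"
    using assms unfolding realised_def by blast
  define I where "I = inv\<^bsub>HolAut SL2\<^esub> F"
  have FC: "F \<in> carrier (HolAut SL2)"
    using F(1) subgroup.subset[OF flow_group_subgroup] by blast
  have I: "I \<in> flow_group SL2 fields"
    unfolding I_def by (rule subgroup.m_inv_closed[OF flow_group_subgroup F(1)])
  have "I \<otimes>\<^bsub>HolAut SL2\<^esub> F = \<one>\<^bsub>HolAut SL2\<^esub>"
    unfolding I_def by (rule group.l_inv[OF group_HolAut FC])
  then have IF: "compose SL2 I F = (\<lambda>A\<in>SL2. A)"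
    using flow_group_Bij[OF F(1)] flow_group_Bij[OF I]
    by (simp add: HolAut_def BijGroup_def)
  have "I (f A) = A" if "A \<in> SL2" for A
    using fun_cong[OF IF, of A] that F(2) by (simp add: compose_def)
  moreover have "realised I" using I by (rule realisedI) simp
  ultimately show ?thesis using that by blast
qed

lemma realised_flow:
  assumes "complex_flow SL2 X \<phi>" "X \<in> fields"
  shows "realised (\<phi> t)"
proof -
  have "restrict (\<phi> t) SL2 \<in> flow_maps SL2 X"
    unfolding flow_maps_def using assms(1) by blast
  then have "restrict (\<phi> t) SL2 \<in> flow_group SL2 fields"
    unfolding flow_group_def using assms(2) by (intro generate.incl) blast
  then show ?thesis by (rule realisedI) simp
qed


section \<open>Shears\<close>

text \<open>
  The amount of a shear is a function of the point. When it depends only on the row that is kept,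
  it is constant along the shear, and such shears commute and their amounts add.
\<close>

definition lower_shear :: "(complex^2^2 \<Rightarrow> complex) \<Rightarrow> complex^2^2 \<Rightarrow> complex^2^2" where
  "lower_shear f A = mat2 (ent_a A) (ent_b A) (ent_c A + f A * ent_a A) (ent_d A + f A * ent_b A)"

definition upper_shear :: "(complex^2^2 \<Rightarrow> complex) \<Rightarrow> complex^2^2 \<Rightarrow> complex^2^2" where
  "upper_shear f A = mat2 (ent_a A + f A * ent_c A) (ent_b A + f A * ent_d A) (ent_c A) (ent_d A)"

lemma lower_shear_entries [simp]:
  "ent_a (lower_shear f A) = ent_a A" "ent_b (lower_shear f A) = ent_b A"
  "ent_c (lower_shear f A) = ent_c A + f A * ent_a A"
  "ent_d (lower_shear f A) = ent_d A + f A * ent_b A"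
  by (simp_all add: lower_shear_def)

lemma upper_shear_entries [simp]:
  "ent_a (upper_shear f A) = ent_a A + f A * ent_c A"
  "ent_b (upper_shear f A) = ent_b A + f A * ent_d A"
  "ent_c (upper_shear f A) = ent_c A" "ent_d (upper_shear f A) = ent_d A"
  by (simp_all add: upper_shear_def)

lemma entries_eqI:
  fixes A B :: "complex^2^2"
  assumes "ent_a A = ent_a B" "ent_b A = ent_b B" "ent_c A = ent_c B" "ent_d A = ent_d B"
  shows "A = B"
  using assms by (simp add: vec_eq_iff forall_2)

lemma SL2_iff: "A \<in> SL2 \<longleftrightarrow> ent_a A * ent_d A - ent_b A * ent_c A = 1"
  by (simp add: SL2_def det_2)

lemma realised_lower_const: "realised (lower_shear (\<lambda>_. s))"
proof (rule realised_cong)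
  show "realised (W_flow s)" by (rule realised_flow[OF W_complete]) simp
  show "W_flow s A = lower_shear (\<lambda>_. s) A" for A
    by (rule entries_eqI) (simp_all add: W_flow_def)
qed

lemma realised_upper_const: "realised (upper_shear (\<lambda>_. s))"
proof (rule realised_cong)
  show "realised (V_flow s)" by (rule realised_flow[OF V_complete]) simp
  show "V_flow s A = upper_shear (\<lambda>_. s) A" for A
    by (rule entries_eqI) (simp_all add: V_flow_def)
qed

text \<open>
  The entries of the explicit flow of \<open>d W\<close> differ from a shear only by the identity
  \<open>z * exp_prim t z = exp (z * t) - 1\<close>; likewise for \<open>(b + c) W\<close> below.
\<close>

lemma realised_lower_d: "realised (lower_shear (\<lambda>A. ent_d A * exp_prim t (ent_b A)))"
proof (rule realised_cong)
  show "realised (dW_flow t)" by (rule realised_flow[OF dW_complete]) simp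
  have "exp_prim t z * z = exp (z * t) - 1" for z
    using exp_prim_mult[of z t] by (simp add: mult.commute)
  then show "dW_flow t A = lower_shear (\<lambda>A. ent_d A * exp_prim t (ent_b A)) A" for A
    by (intro entries_eqI) (simp_all add: dW_flow_def mult.assoc right_diff_distrib)
qed

lemma realised_lower_bc: "realised (lower_shear (\<lambda>A. (ent_b A + ent_c A) * exp_prim t (ent_a A)))"
proof (rule realised_cong)
  show "realised (bcW_flow t)" by (rule realised_flow[OF bcW_complete]) simp
  have "exp_prim t z * z = exp (z * t) - 1" for z
    using exp_prim_mult[of z t] by (simp add: mult.commute)
  then show "bcW_flow t A = lower_shear (\<lambda>A. (ent_b A + ent_c A) * exp_prim t (ent_a A)) A" for A
    by (intro entries_eqI) (simp_all add: bcW_flow_def mult.assoc right_diff_distrib)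
qed

lemma exp_prim_minus: "exp (z * t) * exp_prim (- t) z = - exp_prim t z"
  by (simp add: exp_prim_def exp_minus field_simps)

text \<open>
  Along a lower shear with amount \<open>h\<close>, a function \<open>f\<close> such as \<open>d\<close> or \<open>b + c\<close> grows by \<open>h * l\<close>, where
  \<open>l\<close> (\<open>b\<close> or \<open>a\<close>) is unchanged. Conjugating the flow of \<open>f W\<close> with that of \<open>W\<close> gives the flow of
  \<open>(f - s * l) W\<close>. Both flows multiply by the same factor \<open>exp (t * l)\<close>, so running one backward
  and the other forward cancels the dependence on \<open>f\<close>: the total amount is
  \<open>s * (exp (t * l) - 1)\<close>, and \<open>W\<close> supplies the missing \<open>s\<close>.
\<close>

lemma realised_lower_exp:
  assumes f: "\<And>h A. f (lower_shear h A) = f A + h A * l A"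
    and l: "\<And>h A. l (lower_shear h A) = l A"
    and flow: "\<And>t. realised (lower_shear (\<lambda>A. f A * exp_prim t (l A)))"
  shows "realised (lower_shear (\<lambda>A. s * exp (t * l A)))"
proof -
  let ?W = "\<lambda>s. lower_shear (\<lambda>_. s)"
  let ?F = "\<lambda>t. lower_shear (\<lambda>A. f A * exp_prim t (l A))"
  have "realised (\<lambda>A. ?W s (?F t (?W s (?F (- t) (?W (- s) A)))))"
    by (rule realised_compose[OF realised_lower_const realised_compose[OF flow
          realised_compose[OF realised_lower_const realised_compose[OF flow realised_lower_const]]]])
  then show ?thesis
  proof (rule realised_cong)
    fix A
    define z where "z = l A"
    define P Q e where "P = exp_prim t z" and "Q = exp_prim (- t) z" and "e = exp (z * t)"
    have 1: "z * P = e - 1" by (simp add: P_def e_def exp_prim_mult)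
    have 2: "e * Q = - P" by (simp add: P_def Q_def e_def exp_prim_minus)
    \<comment> \<open>the value of \<open>f\<close> after the first, constant shear\<close>
    define w where "w = f A - s * z"
    have amount: "- s + w * Q + s + (w + z * (w * Q + s)) * P + s = s * e"
    proof -
      have "- s + w * Q + s + (w + z * (w * Q + s)) * P + s
          = w * Q + w * P + (z * P) * (w * Q + s) + s" by algebra
      also have "\<dots> = w * P + w * (e * Q) + s * e" unfolding 1 by algebra
      finally show ?thesis unfolding 2 by simp
    qed
    have comb: "?W s (?F t (?W s (?F (- t) (?W (- s) A))))
       = ?W (- s + w * Q + s + (w + z * (w * Q + s)) * P + s) A"
      by (rule entries_eqI)
         (simp_all add: f l w_def z_def[symmetric] P_def[symmetric] Q_def[symmetric] algebra_simps)
    show "?W s (?F t (?W s (?F (- t) (?W (- s) A)))) = lower_shear (\<lambda>A. s * exp (t * l A)) A"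
      unfolding comb amount
      by (rule entries_eqI) (simp_all add: e_def z_def mult.commute)
  qed
qed

lemma realised_lower_exp_a: "realised (lower_shear (\<lambda>A. s * exp (t * ent_a A)))"
  by (rule realised_lower_exp[of "\<lambda>A. ent_b A + ent_c A" ent_a])
     (simp_all add: realised_lower_bc)

lemma realised_lower_exp_b: "realised (lower_shear (\<lambda>A. s * exp (t * ent_b A)))"
  by (rule realised_lower_exp[of ent_d ent_b]) (simp_all add: realised_lower_d)

text \<open>
  The powers of \<open>exp (t * a)\<close> are again exponentials, and the shears by the individual monomials
  commute because they do not change \<open>a\<close>.
\<close>

lemma realised_lower_poly: "realised (lower_shear (\<lambda>A. poly p (exp (t * ent_a A))))"
proof -
  have "realised (lower_shear (\<lambda>A. \<Sum>i<n. coeff p i * exp (t * ent_a A) ^ i))" for n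
  proof (induction n)
    case 0
    show ?case
      by (rule realised_cong[OF realised_id]) (rule entries_eqI, simp_all)
  next
    case (Suc n)
    show ?case
    proof (rule realised_cong[OF realised_compose[OF Suc
            realised_lower_exp_a[of "coeff p n" "of_nat n * t"]]])
      fix A :: "complex^2^2"
      have "exp (of_nat n * t * ent_a A) = exp (t * ent_a A) ^ n"
        by (simp add: mult.assoc exp_of_nat_mult)
      then show "lower_shear (\<lambda>A. \<Sum>i<n. coeff p i * exp (t * ent_a A) ^ i)
          (lower_shear (\<lambda>A. coeff p n * exp (of_nat n * t * ent_a A)) A)
        = lower_shear (\<lambda>A. \<Sum>i<Suc n. coeff p i * exp (t * ent_a A) ^ i) A"
        by (intro entries_eqI) (simp_all add: algebra_simps)
    qed
  qed
  from this[of "Suc (degree p)"] show ?thesis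
    by (simp add: poly_altdef lessThan_Suc_atMost)
qed

text \<open>
  Dividing by a bound on the norms moves \<open>Z\<close> into the unit disc, which is contained in a strip
  of height less than \<open>2 * pi\<close>, where the exponential is injective.
\<close>

lemma exp_separates:
  fixes Z :: "complex set"
  assumes "finite Z"
  obtains t :: complex where "inj_on (\<lambda>z. exp (t * z)) Z"
proof -
  define M where "M = 1 + (\<Sum>z\<in>Z. norm z)"
  have M: "M \<ge> 1" unfolding M_def by (simp add: sum_nonneg)
  have small: "norm (z / of_real M) \<le> 1" if "z \<in> Z" for z
  proof -
    have "norm z \<le> (\<Sum>z\<in>Z. norm z)" using assms that by (intro member_le_sum) auto
    then have "norm z \<le> M" by (simp add: M_def)
    then show ?thesis using M by (simp add: norm_divide)
  qed
  have "inj_on (\<lambda>z. exp (inverse (of_real M) * z)) Z"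
  proof (rule inj_onI)
    fix z w assume z: "z \<in> Z" and w: "w \<in> Z"
      and eq: "exp (inverse (of_real M) * z) = exp (inverse (of_real M) * w)"
    have "z / of_real M = w / of_real M"
    proof (rule exp_complex_eqI)
      have "\<bar>Im (z / of_real M)\<bar> \<le> 1" "\<bar>Im (w / of_real M)\<bar> \<le> 1"
        using small[OF z] small[OF w] abs_Im_le_cmod order_trans by blast+
      then show "\<bar>Im (z / of_real M) - Im (w / of_real M)\<bar> < 2 * pi"
        using pi_gt3 by linarith
      show "exp (z / of_real M) = exp (w / of_real M)"
        using eq by (simp add: field_simps)
    qed
    then show "z = w" using M by simp
  qed
  then show ?thesis using that by blast
qed

text \<open>
  Interpolation by a multiple of the polynomial in \<open>exp (t * x)\<close> that vanishes exactly at the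
  points of \<open>Z\<close>, with \<open>t\<close> chosen so that \<open>z\<close> remains separated from \<open>Z\<close>.
\<close>

lemma realised_lower_delta:
  assumes "finite Z" "z \<notin> Z"
  obtains \<sigma> where "realised (lower_shear (\<lambda>A. \<sigma> (ent_a A)))" "\<sigma> z = s" "\<forall>w\<in>Z. \<sigma> w = 0"
proof -
  obtain t where t: "inj_on (\<lambda>z. exp (t * z)) (insert z Z)"
    using exp_separates[of "insert z Z"] assms(1) by blast
  define p where "p = (\<Prod>w\<in>Z. [:- exp (t * w), 1:])"
  have "poly p (exp (t * z)) \<noteq> 0"
    using assms inj_onD[OF t, of z] by (auto simp: p_def poly_prod)
  moreover have "poly p (exp (t * w)) = 0" if "w \<in> Z" for w
    using assms(1) that by (auto simp: p_def poly_prod)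
  ultimately show ?thesis
    by (intro that[of "\<lambda>x. poly (smult (s / poly p (exp (t * z))) p) (exp (t * x))"])
       (simp_all add: realised_lower_poly del: poly_smult, simp_all)
qed

text \<open>
  The matrix with rows \<open>(0, 1)\<close> and \<open>(-1, 0)\<close> is a product of three constant shears. It carries
  the rows \<open>(r, r')\<close> to \<open>(r', -r)\<close>, so that conjugation by it turns a lower shear with amount
  \<open>\<sigma> a\<close> into an upper shear with amount \<open>- \<sigma> c\<close>.
\<close>

lemma realised_upper_delta:
  assumes "finite Z" "z \<notin> Z"
  obtains \<sigma> where "realised (upper_shear (\<lambda>A. \<sigma> (ent_c A)))" "\<sigma> z = s" "\<forall>w\<in>Z. \<sigma> w = 0"
proof -
  obtain \<sigma> where \<sigma>: "realised (lower_shear (\<lambda>A. \<sigma> (ent_a A)))" "\<sigma> z = - s" "\<forall>w\<in>Z. \<sigma> w = 0"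
    using realised_lower_delta[OF assms] .
  let ?U = "\<lambda>s. upper_shear (\<lambda>_. s)" and ?L = "\<lambda>s. lower_shear (\<lambda>_. s)"
  have "realised (\<lambda>A. ?U (-1) (?L 1 (?U (-1)
      (lower_shear (\<lambda>A. \<sigma> (ent_a A)) (?U 1 (?L (-1) (?U 1 A)))))))"
    by (rule realised_compose[OF realised_upper_const realised_compose[OF realised_lower_const
          realised_compose[OF realised_upper_const realised_compose[OF \<sigma>(1)
          realised_compose[OF realised_upper_const realised_compose[OF realised_lower_const
          realised_upper_const]]]]]])
  then have "realised (upper_shear (\<lambda>A. - \<sigma> (ent_c A)))"
    by (rule realised_cong) (rule entries_eqI, simp_all add: algebra_simps)
  with \<sigma> show ?thesis by (intro that[of "\<lambda>x. - \<sigma> x"]) simp_all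
qed


section \<open>General position\<close>

text \<open>
  The source of every generic choice below: each \<open>(\<alpha>, \<beta>)\<close> other than \<open>(0, 0)\<close> excludes at most one
  value of \<open>t\<close>.
\<close>

lemma affine_avoid_zero:
  fixes K :: "(complex \<times> complex) set"
  assumes "finite K" "(0, 0) \<notin> K"
  obtains t where "\<And>\<alpha> \<beta>. (\<alpha>, \<beta>) \<in> K \<Longrightarrow> \<alpha> + t * \<beta> \<noteq> 0"
proof -
  have "finite ((\<lambda>(\<alpha>, \<beta>). - \<alpha> / \<beta>) ` K)" using assms(1) by simp
  then obtain t where t: "t \<notin> (\<lambda>(\<alpha>, \<beta>). - \<alpha> / \<beta>) ` K"
    using ex_new_if_finite[OF infinite_UNIV_char_0] by blast
  have "\<alpha> + t * \<beta> \<noteq> 0" if K: "(\<alpha>, \<beta>) \<in> K" for \<alpha> \<beta>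
  proof
    assume eq: "\<alpha> + t * \<beta> = 0"
    show False
    proof (cases "\<beta> = 0")
      case True
      with eq K assms(2) show False by simp
    next
      case False
      with eq have "t = - \<alpha> / \<beta>" by (simp add: eq_divide_eq add_eq_0_iff2)
      with t K show False by force
    qed
  qed
  then show ?thesis using that by blast
qed

lemma first_column_nonzero: "A \<in> SL2 \<Longrightarrow> (ent_a A, ent_c A) \<noteq> (0, 0)"
  by (auto simp: SL2_iff)

lemma affine_combination_generic:
  fixes f g :: "complex^2^2 \<Rightarrow> complex"
  assumes "finite P" "\<And>A. A \<in> P \<Longrightarrow> (f A, g A) \<noteq> (0, 0)" "inj_on (\<lambda>A. (f A, g A)) P"
  obtains t where "inj_on (\<lambda>A. f A + t * g A) P" "\<And>A. A \<in> P \<Longrightarrow> f A + t * g A \<noteq> 0"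
proof -
  let ?K = "(\<lambda>A. (f A, g A)) ` P
    \<union> (\<lambda>(A, B). (f A - f B, g A - g B)) ` {(A, B) \<in> P \<times> P. A \<noteq> B}"
  have fin: "finite ?K"
    using assms(1) finite_subset[of "{(A, B) \<in> P \<times> P. A \<noteq> B}" "P \<times> P"] by auto
  have "(0, 0) \<notin> ?K" using assms(2,3) by (force simp: inj_on_def)
  then obtain t where t: "\<And>\<alpha> \<beta>. (\<alpha>, \<beta>) \<in> ?K \<Longrightarrow> \<alpha> + t * \<beta> \<noteq> 0"
    using affine_avoid_zero[OF fin] by blast
  have "inj_on (\<lambda>A. f A + t * g A) P"
  proof (rule inj_onI, rule ccontr)
    fix A B assume AB: "A \<in> P" "B \<in> P" "f A + t * g A = f B + t * g B" "A \<noteq> B"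
    then have "(f A - f B, g A - g B) \<in> ?K" by force
    from t[OF this] AB(3) show False by (simp add: algebra_simps)
  qed
  moreover have "f A + t * g A \<noteq> 0" if "A \<in> P" for A
    using t[of "f A" "g A"] that by blast
  ultimately show ?thesis using that by blast
qed

text \<open>
  Constant matrices act on the two columns separately and cannot separate points with the same
  first column. A shear with amount depending on \<open>b\<close> can: if \<open>a\<close> is nonzero, then \<open>a\<close>, \<open>b\<close> and
  \<open>c\<close> determine \<open>d\<close>, so different points of \<open>SL2\<close> with equal first columns differ in \<open>b\<close>.
\<close>

lemma separate_first_columns:
  assumes "finite P" "P \<subseteq> SL2" "\<And>A. A \<in> P \<Longrightarrow> ent_a A \<noteq> 0"
  obtains h where "realised (lower_shear h)"
    "inj_on (\<lambda>A. (ent_a A, ent_c (lower_shear h A))) P"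
proof -
  obtain \<tau> where \<tau>: "inj_on (\<lambda>z. exp (\<tau> * z)) (ent_b ` P)"
    using exp_separates[of "ent_b ` P"] assms(1) by blast
  define g where "g A = ent_a A * exp (\<tau> * ent_b A)" for A
  let ?I = "{(A, B) \<in> P \<times> P. A \<noteq> B \<and> ent_a A = ent_a B}"
  let ?K = "(\<lambda>(A, B). (ent_c A - ent_c B, g A - g B)) ` ?I"
  have fin: "finite ?K"
    using assms(1) finite_subset[of ?I "P \<times> P"] by auto
  have "(0, 0) \<notin> ?K"
  proof
    assume "(0, 0) \<in> ?K"
    then obtain A B where AB: "A \<in> P" "B \<in> P" "A \<noteq> B" "ent_a A = ent_a B" "ent_c A = ent_c B"
      "g A = g B" by auto
    have "exp (\<tau> * ent_b A) = exp (\<tau> * ent_b B)"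
      using AB assms(3)[of B] by (simp add: g_def)
    then have b: "ent_b A = ent_b B" using inj_onD[OF \<tau>] AB(1,2) by blast
    have "ent_a A * ent_d A - ent_b A * ent_c A = 1" "ent_a B * ent_d B - ent_b B * ent_c B = 1"
      using AB assms(2) by (auto simp: SL2_iff)
    then have "ent_a B * ent_d A = ent_a B * ent_d B" using AB(4,5) b
      by (simp add: algebra_simps)
    then have "ent_d A = ent_d B" using assms(3)[OF AB(2)] by simp
    with AB b show False using entries_eqI by blast
  qed
  then obtain s where s: "\<And>\<alpha> \<beta>. (\<alpha>, \<beta>) \<in> ?K \<Longrightarrow> \<alpha> + s * \<beta> \<noteq> 0"
    using affine_avoid_zero[OF fin] by blast
  have "inj_on (\<lambda>A. (ent_a A, ent_c (lower_shear (\<lambda>A. s * exp (\<tau> * ent_b A)) A))) P"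
  proof (rule inj_onI, rule ccontr)
    fix A B assume AB: "A \<in> P" "B \<in> P" "A \<noteq> B"
      "(ent_a A, ent_c (lower_shear (\<lambda>A. s * exp (\<tau> * ent_b A)) A))
       = (ent_a B, ent_c (lower_shear (\<lambda>A. s * exp (\<tau> * ent_b A)) B))"
    then have "(ent_c A - ent_c B, g A - g B) \<in> ?K" by force
    from s[OF this] AB(4) show False by (simp add: g_def algebra_simps)
  qed
  then show ?thesis using that realised_lower_exp_b by blast
qed

text \<open>
  Four shears: the first makes \<open>a\<close> nonzero, the second separates the first columns, and after
  that a generic multiple of \<open>c\<close> added to \<open>a\<close>, followed by a generic multiple of \<open>a\<close> added to \<open>c\<close>,
  separates the single entries.
\<close>

lemma general_position:
  assumes "finite P" "P \<subseteq> SL2"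
  obtains f where "realised f" "inj_on (\<lambda>A. ent_a (f A)) P" "inj_on (\<lambda>A. ent_c (f A)) P"
    "\<And>A. A \<in> P \<Longrightarrow> ent_a (f A) \<noteq> 0" "\<And>A. A \<in> P \<Longrightarrow> ent_c (f A) \<noteq> 0"
proof -
  have "(0, 0) \<notin> (\<lambda>A. (ent_a A, ent_c A)) ` P" using first_column_nonzero assms(2) by force
  with assms(1) obtain t where t:
    "\<And>\<alpha> \<beta>. (\<alpha>, \<beta>) \<in> (\<lambda>A. (ent_a A, ent_c A)) ` P \<Longrightarrow> \<alpha> + t * \<beta> \<noteq> 0"
    using affine_avoid_zero[of "(\<lambda>A. (ent_a A, ent_c A)) ` P"] by blast
  define f1 where "f1 = upper_shear (\<lambda>_. t)"
  have r1: "realised f1" unfolding f1_def by (rule realised_upper_const)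
  have a1: "ent_a (f1 A) \<noteq> 0" if "A \<in> P" for A
    using t that by (force simp: f1_def)
  have inj1: "inj_on f1 P"
    using realised_inverse[OF r1] assms(2) by (metis inj_on_def subsetD)
  obtain h where h: "realised (lower_shear h)"
    "inj_on (\<lambda>A. (ent_a A, ent_c (lower_shear h A))) (f1 ` P)"
    by (rule separate_first_columns[of "f1 ` P"])
       (use assms realised_mem[OF r1] a1 in auto)
  define f2 where "f2 A = lower_shear h (f1 A)" for A
  have r2: "realised f2" unfolding f2_def by (rule realised_compose[OF h(1) r1])
  have inj2: "inj_on (\<lambda>A. (ent_a (f2 A), ent_c (f2 A))) P"
    using comp_inj_on[OF inj1 h(2)] by (simp add: f2_def o_def)
  have nz2: "(ent_a (f2 A), ent_c (f2 A)) \<noteq> (0, 0)" if "A \<in> P" for A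
    using first_column_nonzero realised_mem[OF r2] assms(2) that by blast
  obtain u where u: "inj_on (\<lambda>A. ent_a (f2 A) + u * ent_c (f2 A)) P"
    "\<And>A. A \<in> P \<Longrightarrow> ent_a (f2 A) + u * ent_c (f2 A) \<noteq> 0"
    using affine_combination_generic[OF assms(1) nz2 inj2] by blast
  define f3 where "f3 A = upper_shear (\<lambda>_. u) (f2 A)" for A
  have r3: "realised f3" unfolding f3_def by (rule realised_compose[OF realised_upper_const r2])
  have a3: "inj_on (\<lambda>A. ent_a (f3 A)) P" "\<And>A. A \<in> P \<Longrightarrow> ent_a (f3 A) \<noteq> 0"
    using u by (simp_all add: f3_def)
  obtain v where v: "inj_on (\<lambda>A. ent_c (f3 A) + v * ent_a (f3 A)) P"
    "\<And>A. A \<in> P \<Longrightarrow> ent_c (f3 A) + v * ent_a (f3 A) \<noteq> 0"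
  proof (rule affine_combination_generic[OF assms(1)])
    show "inj_on (\<lambda>A. (ent_c (f3 A), ent_a (f3 A))) P"
      using a3(1) by (simp add: inj_on_def)
  qed (use a3(2) in auto)
  show ?thesis
  proof (rule that[of "\<lambda>A. lower_shear (\<lambda>_. v) (f3 A)"])
    show "realised (\<lambda>A. lower_shear (\<lambda>_. v) (f3 A))"
      by (rule realised_compose[OF realised_lower_const r3])
  qed (use a3 v in simp_all)
qed


section \<open>Moving one point and fixing finitely many others\<close>

text \<open>
  The interpolating shear takes the value \<open>s\<close> at the entry \<open>a\<close> of \<open>x\<close> and vanishes at those of the
  points of \<open>E\<close>; for upper shears the entry \<open>c\<close> takes the place of \<open>a\<close>.
\<close>

lemma lower_shear_one_point:
  assumes "finite E" "ent_a x \<notin> ent_a ` E"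
  obtains f where "realised f" "f x = lower_shear (\<lambda>_. s) x" "\<forall>e\<in>E. f e = e"
proof -
  obtain \<sigma> where \<sigma>: "realised (lower_shear (\<lambda>A. \<sigma> (ent_a A)))" "\<sigma> (ent_a x) = s"
    "\<forall>w\<in>ent_a ` E. \<sigma> w = 0"
    using realised_lower_delta[of "ent_a ` E"] assms by blast
  show ?thesis
    by (rule that[OF \<sigma>(1)]) (use \<sigma> in \<open>auto intro!: entries_eqI\<close>)
qed

lemma upper_shear_one_point:
  assumes "finite E" "ent_c x \<notin> ent_c ` E"
  obtains f where "realised f" "f x = upper_shear (\<lambda>_. s) x" "\<forall>e\<in>E. f e = e"
proof -
  obtain \<sigma> where \<sigma>: "realised (upper_shear (\<lambda>A. \<sigma> (ent_c A)))" "\<sigma> (ent_c x) = s"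
    "\<forall>w\<in>ent_c ` E. \<sigma> w = 0"
    using realised_upper_delta[of "ent_c ` E"] assms by blast
  show ?thesis
    by (rule that[OF \<sigma>(1)]) (use \<sigma> in \<open>auto intro!: entries_eqI\<close>)
qed

text \<open>
  A matrix of determinant 1 whose lower left entry \<open>k\<close> is nonzero is a product upper, lower,
  upper of constant shears, the lower one having amount \<open>k\<close>. This is applied to \<open>y x\<^sup>-\<^sup>1\<close> times the
  inverse of a lower shear with free amount \<open>s\<close>. The conditions on the intermediate points are
  affine in \<open>s\<close> after clearing the denominator \<open>k\<close>, so each excludes at most one value of \<open>s\<close>
  unless it degenerates. The condition at \<open>z \<in> Z\<close> can degenerate only if \<open>z\<close> is the entry \<open>a\<close> of
  \<open>x\<close> or the entry \<open>c\<close> of \<open>y\<close> vanishes, and the hypotheses on \<open>x\<close> and \<open>y\<close> rule this out.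
\<close>

lemma four_shears:
  assumes x: "x \<in> SL2" and y: "y \<in> SL2" and fin: "finite Z" "finite Z'"
    and ax: "ent_a x \<notin> Z" "ent_a x \<noteq> 0" and cy: "ent_c y \<noteq> 0"
  obtains s1 t1 s2 t2 where
    "upper_shear (\<lambda>_. t2) (lower_shear (\<lambda>_. s2)
       (upper_shear (\<lambda>_. t1) (lower_shear (\<lambda>_. s1) x))) = y"
    "ent_c (lower_shear (\<lambda>_. s1) x) \<notin> Z'"
    "ent_a (upper_shear (\<lambda>_. t1) (lower_shear (\<lambda>_. s1) x)) \<notin> Z"
proof -
  obtain a b c d where abcd: "a = ent_a x" "b = ent_b x" "c = ent_c x" "d = ent_d x" by blast
  obtain a' b' c' d' where abcd': "a' = ent_a y" "b' = ent_b y" "c' = ent_c y" "d' = ent_d y"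
    by blast
  have det: "a * d - b * c = 1" "a' * d' - b' * c' = 1"
    using x y by (simp_all add: SL2_iff abcd abcd')
  \<comment> \<open>the entries of \<open>y x\<^sup>-\<^sup>1\<close>\<close>
  define \<alpha> \<beta> \<gamma> \<delta> where "\<alpha> = a' * d - b' * c" and "\<beta> = b' * a - a' * b"
    and "\<gamma> = c' * d - d' * c" and "\<delta> = d' * a - c' * b"
  have det': "\<alpha> * \<delta> - \<beta> * \<gamma> = 1"
    using det unfolding \<alpha>_def \<beta>_def \<gamma>_def \<delta>_def by algebra
  have y_eq: "a' = \<alpha> * a + \<beta> * c" "b' = \<alpha> * b + \<beta> * d"
    "c' = \<gamma> * a + \<delta> * c" "d' = \<gamma> * b + \<delta> * d"
    using det(1) unfolding \<alpha>_def \<beta>_def \<gamma>_def \<delta>_def by algebra+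
  \<comment> \<open>the conditions \<open>k \<noteq> 0\<close>, \<open>c + s * a \<notin> Z'\<close>, and \<open>k * (a\<^sub>2 - z) \<noteq> 0\<close> for \<open>z \<in> Z\<close>, where \<open>a\<^sub>2\<close> is
    the entry \<open>a\<close> after two shears, each written as \<open>\<mu> + s * \<nu> \<noteq> 0\<close>\<close>
  define K where "K = {(\<gamma>, - \<delta>)} \<union> (\<lambda>z. (c - z, a)) ` Z'
    \<union> (\<lambda>z. (a * \<gamma> + (\<delta> - 1) * c - z * \<gamma>, z * \<delta> - a)) ` Z"
  have nz: "(0, 0) \<notin> K"
  proof
    assume "(0, 0) \<in> K"
    then consider "\<gamma> = 0 \<and> \<delta> = 0" | "a = 0"
      | z where "z \<in> Z" "a * \<gamma> + (\<delta> - 1) * c - z * \<gamma> = 0" "z * \<delta> = a"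
      by (auto simp: K_def)
    then show False
    proof cases
      case 1
      then show False using det' by simp
    next
      case 2
      then show False using ax abcd by simp
    next
      case 3
      from 3(2,3) have "(\<delta> - 1) * (c + z * \<gamma>) = 0" by algebra
      then consider "\<delta> = 1" | "c = - z * \<gamma>" by (auto simp: add_eq_0_iff2)
      then show False
      proof cases
        case 1
        then show False using 3 ax abcd by simp
      next
        case 2
        then have "c' = 0" using y_eq(3) 3(3) by algebra
        then show False using cy abcd' by simp
      qed
    qed
  qed
  have "finite K" using fin by (simp add: K_def)
  then obtain s where s: "\<And>\<mu> \<nu>. (\<mu>, \<nu>) \<in> K \<Longrightarrow> \<mu> + s * \<nu> \<noteq> 0"
    using affine_avoid_zero nz by blast
  \<comment> \<open>the lower left entry of \<open>y x\<^sup>-\<^sup>1\<close> after the first shear has been split off\<close>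
  define k where "k = \<gamma> - s * \<delta>"
  have k: "k \<noteq> 0" using s[of \<gamma> "- \<delta>"] by (simp add: K_def k_def)
  define t1 t2 where "t1 = (\<delta> - 1) / k" and "t2 = (\<alpha> - s * \<beta> - 1) / k"
  have kt: "k * t1 = \<delta> - 1" "k * t2 = \<alpha> - s * \<beta> - 1" using k by (simp_all add: t1_def t2_def)
  \<comment> \<open>the upper right entry is forced by the determinant\<close>
  have beta: "t1 + t2 * (k * t1 + 1) = \<beta>"
  proof -
    have "k * (t1 + t2 * (k * t1 + 1)) = k * \<beta>"
      using det' kt unfolding k_def by algebra
    then show ?thesis using k by simp
  qed
  show ?thesis
  proof (rule that[of t2 k t1 s])
    let ?r = "\<lambda>p q. (p + t1 * (q + s * p)) + t2 * (q + s * p + k * (p + t1 * (q + s * p)))"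
    have row2: "q + s * p + k * (p + t1 * (q + s * p)) = \<gamma> * p + \<delta> * q" for p q
      using kt(1) unfolding k_def by algebra
    have row1: "?r p q = \<alpha> * p + \<beta> * q" for p q
      using kt beta unfolding k_def by algebra
    show "upper_shear (\<lambda>_. t2) (lower_shear (\<lambda>_. k)
       (upper_shear (\<lambda>_. t1) (lower_shear (\<lambda>_. s) x))) = y"
      using row1[of a c] row1[of b d] row2[of c a] row2[of d b] y_eq
      by (intro entries_eqI)
         (simp_all only: lower_shear_entries upper_shear_entries abcd[symmetric] abcd'[symmetric]
            row1 row2)
    show "ent_c (lower_shear (\<lambda>_. s) x) \<notin> Z'"
    proof
      assume "ent_c (lower_shear (\<lambda>_. s) x) \<in> Z'"
      then have "c + s * a \<in> Z'" by (simp add: abcd)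
      then have "(c - (c + s * a), a) \<in> K" unfolding K_def by blast
      from s[OF this] show False by simp
    qed
    show "ent_a (upper_shear (\<lambda>_. t1) (lower_shear (\<lambda>_. s) x)) \<notin> Z"
    proof
      define z where "z = a + t1 * (c + s * a)"
      assume "ent_a (upper_shear (\<lambda>_. t1) (lower_shear (\<lambda>_. s) x)) \<in> Z"
      then have "z \<in> Z" by (simp add: abcd z_def)
      then have "(a * \<gamma> + (\<delta> - 1) * c - z * \<gamma>, z * \<delta> - a) \<in> K" unfolding K_def by blast
      from s[OF this] have "a * \<gamma> + (\<delta> - 1) * c - z * \<gamma> + s * (z * \<delta> - a) \<noteq> 0" .
      moreover have "a * \<gamma> + (\<delta> - 1) * c - z * \<gamma> + s * (z * \<delta> - a) = 0"
        using kt(1) unfolding z_def k_def by algebra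
      ultimately show False by simp
    qed
  qed
qed

lemma move_point_generic:
  assumes E: "finite E" and x: "x \<in> SL2" and y: "y \<in> SL2"
    and ax: "ent_a x \<notin> ent_a ` E" "ent_a x \<noteq> 0"
    and cy: "ent_c y \<notin> ent_c ` E" "ent_c y \<noteq> 0"
  obtains f where "realised f" "f x = y" "\<forall>e\<in>E. f e = e"
proof -
  let ?U = "\<lambda>t. upper_shear (\<lambda>_. t)" and ?L = "\<lambda>s. lower_shear (\<lambda>_. s)"
  obtain s1 t1 s2 t2 where st: "?U t2 (?L s2 (?U t1 (?L s1 x))) = y"
    "ent_c (?L s1 x) \<notin> ent_c ` E" "ent_a (?U t1 (?L s1 x)) \<notin> ent_a ` E"
    using four_shears[OF x y _ _ ax cy(2), of "ent_c ` E"] E by blast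
  have "ent_c (?L s2 (?U t1 (?L s1 x))) = ent_c y"
    unfolding st(1)[symmetric] by simp
  \<comment> \<open>the last shear keeps the second row, so the point before it has the entry \<open>c\<close> of \<open>y\<close>\<close>
  then have c3: "ent_c (?L s2 (?U t1 (?L s1 x))) \<notin> ent_c ` E" using cy(1) by simp
  obtain f1 where f1: "realised f1" "f1 x = ?L s1 x" "\<forall>e\<in>E. f1 e = e"
    using lower_shear_one_point[OF E ax(1)] .
  obtain f2 where f2: "realised f2" "f2 (?L s1 x) = ?U t1 (?L s1 x)" "\<forall>e\<in>E. f2 e = e"
    using upper_shear_one_point[OF E st(2)] .
  obtain f3 where f3: "realised f3" "f3 (?U t1 (?L s1 x)) = ?L s2 (?U t1 (?L s1 x))"
    "\<forall>e\<in>E. f3 e = e"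
    using lower_shear_one_point[OF E st(3)] .
  obtain f4 where f4: "realised f4"
    "f4 (?L s2 (?U t1 (?L s1 x))) = ?U t2 (?L s2 (?U t1 (?L s1 x)))" "\<forall>e\<in>E. f4 e = e"
    using upper_shear_one_point[OF E c3] .
  show ?thesis
  proof (rule that[of "\<lambda>A. f4 (f3 (f2 (f1 A)))"])
    show "realised (\<lambda>A. f4 (f3 (f2 (f1 A))))"
      by (rule realised_compose[OF f4(1) realised_compose[OF f3(1)
            realised_compose[OF f2(1) f1(1)]]])
  qed (use f1 f2 f3 f4 st(1) in simp_all)
qed

text \<open>
  Conjugating with a map that brings \<open>E\<close>, \<open>x\<close> and \<open>y\<close> into general position.
\<close>

lemma move_point:
  assumes E: "finite E" "E \<subseteq> SL2" and x: "x \<in> SL2" "x \<notin> E" and y: "y \<in> SL2" "y \<notin> E"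
  obtains f where "realised f" "f x = y" "\<forall>e\<in>E. f e = e"
proof -
  obtain g where g: "realised g" "inj_on (\<lambda>A. ent_a (g A)) (E \<union> {x, y})"
    "inj_on (\<lambda>A. ent_c (g A)) (E \<union> {x, y})"
    "\<And>A. A \<in> E \<union> {x, y} \<Longrightarrow> ent_a (g A) \<noteq> 0" "\<And>A. A \<in> E \<union> {x, y} \<Longrightarrow> ent_c (g A) \<noteq> 0"
    by (rule general_position[of "E \<union> {x, y}"]) (use E x y in auto)
  obtain g' where g': "realised g'" "\<And>A. A \<in> SL2 \<Longrightarrow> g' (g A) = A"
    using realised_inverse[OF g(1)] by blast
  have "ent_a (g x) \<notin> ent_a ` g ` E" "ent_c (g y) \<notin> ent_c ` g ` E"
    using inj_onD[OF g(2)] inj_onD[OF g(3)] x(2) y(2) by blast+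
  then obtain f where f: "realised f" "f (g x) = g y" "\<forall>e\<in>g ` E. f e = e"
    using move_point_generic[of "g ` E" "g x" "g y"] E(1) realised_mem[OF g(1)] x(1) y(1) g(4,5)
    by blast
  show ?thesis
  proof (rule that[of "\<lambda>A. g' (f (g A))"])
    show "realised (\<lambda>A. g' (f (g A)))" 
      by (rule realised_compose[OF g'(1) realised_compose[OF f(1) g(1)]])
  qed (use f g' E(2) y(1) in auto)
qed

text \<open>
  Once the first \<open>m\<close> points are in place, the image of the next one is moved to its target
  while the targets reached so far are fixed.
\<close>

lemma realised_transitive:
  fixes p q :: "nat \<Rightarrow> complex^2^2"
  assumes "p ` {1..m} \<subseteq> SL2" "inj_on p {1..m}" "q ` {1..m} \<subseteq> SL2" "inj_on q {1..m}"
  shows "\<exists>f. realised f \<and> (\<forall>j\<in>{1..m}. f (p j) = q j)"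
  using assms
proof (induction m)
  case 0
  then show ?case using realised_id by auto
next
  case (Suc m)
  have sub: "{Suc 0..Suc m} = insert (Suc m) {Suc 0..m}" by auto
  obtain f where f: "realised f" "\<forall>j\<in>{1..m}. f (p j) = q j"
    using Suc by (auto simp: sub)
  have mem: "f (p (Suc m)) \<in> SL2" using realised_mem[OF f(1)] Suc.prems by (simp add: sub)
  obtain f' where f': "realised f'" "\<And>A. A \<in> SL2 \<Longrightarrow> f' (f A) = A"
    using realised_inverse[OF f(1)] by blast
  have new: "f (p (Suc m)) \<notin> q ` {1..m}"
  proof
    assume "f (p (Suc m)) \<in> q ` {1..m}"
    then obtain j where j: "j \<in> {1..m}" "f (p (Suc m)) = f (p j)" using f(2) by auto
    moreover have "p (Suc m) \<in> SL2" "p j \<in> SL2" using j(1) Suc.prems(1) by (auto simp: sub)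
    ultimately have "p (Suc m) = p j" using f'(2) by metis
    with j(1) have "p (Suc m) \<in> p ` {1..m}" by blast
    moreover have "p (Suc m) \<notin> p ` {1..m}"
      by (subst inj_on_image_mem_iff[OF Suc.prems(2)]) auto
    ultimately show False by contradiction
  qed
  have "q (Suc m) \<notin> q ` {1..m}"
    by (subst inj_on_image_mem_iff[OF Suc.prems(4)]) auto
  then obtain h where h: "realised h" "h (f (p (Suc m))) = q (Suc m)" "\<forall>e\<in>q ` {1..m}. h e = e"
    using move_point[of "q ` {1..m}", OF _ _ mem new] Suc.prems(3) by (auto simp: sub)
  show ?case
  proof (intro exI conjI)
    show "realised (\<lambda>A. h (f A))" by (rule realised_compose[OF h(1) f(1)])
  qed (use f h in \<open>auto simp: sub\<close>)
qed

theorem corollary15: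
  shows "infinitely_transitive
    (flow_group SL2
      {V_field, W_field,
       mult_field (\<lambda>A. ent_b A + ent_c A) W_field,
       mult_field (\<lambda>A. ent_d A) W_field})
    SL2"
  unfolding infinitely_transitive_def m_transitive_def
proof (intro allI impI)
  fix m :: nat and p q :: "nat \<Rightarrow> complex^2^2"
  assume pq: "p ` {1..m} \<subseteq> SL2 \<and> inj_on p {1..m} \<and> q ` {1..m} \<subseteq> SL2 \<and> inj_on q {1..m}"
  then obtain f where f: "realised f" "\<forall>j\<in>{1..m}. f (p j) = q j"
    using realised_transitive[of p m q] by blast
  from f(1) obtain F where F: "F \<in> flow_group SL2 fields" "\<forall>A\<in>SL2. F A = f A"
    unfolding realised_def by blast
  have "F (p j) = q j" if "j \<in> {1..m}" for j
    using F(2) f(2) pq that by (metis image_subset_iff)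
  with F(1) show "\<exists>F\<in>flow_group SL2 fields. \<forall>j\<in>{1..m}. F (p j) = q j" by blast
qed

end
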